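(* Let $f_i(t,\xi,u)=g_i(t,\xi,u_i)+h_i(t,\xi,u)$ for $i\in\{1,\dots,r\}$, $t\ge 0$, $\xi\in\mathcal{O}$, $u\in\mathbb{R}^r$, where for every $i,t,\xi$ the function $\mathbb{R}\ni y\mapsto g_i(t,\xi,y)$ is continuous and non-increasing ($g_i(t,\xi,y)-g_i(t,\xi,y')\le 0$ whenever $y>y'$), and there is an increasing function $L:[0,\infty)\to[0,\infty)$ such that for all $t\ge 0$, $x,y\in\mathbb{R}^r$, $$\sup_{i}\sup_{s\in[0,t]}\sup_{\xi\in\mathcal{O}}|h_i(s,\xi,x)-h_i(s,\xi,y)|\le L(t)\sup_i|x_i-y_i|,\qquad \sup_{i}\sup_{s\in[0,t]}\sup_{\xi\in\mathcal{O}}|h_i(s,\xi,x)|\le L(t)\Big(1+\sup_i|x_i|\Big).$$ For $z\in E_T$ let $\mathcal{M}(z)\in E_T$ denote a solution of $$\mathcal{M}(z)(t)=\int_0^tS(t-s)F(s,\mathcal{M}(z)(s))\,ds+z(t),\qquad t\in[0,T].$$ Then for any $T>0$, $\mathcal{M}$ is a Lipschitz continuous operator from $E_T$ to $E_T$: there exists $C_T>0$ (for the given $T$) depending only on $L(T)$ such that for any $z_1,z_2\in E_T$, $$|\mathcal{M}(z_1)-\mathcal{M}(z_2)|_{E_T}\le C_T|z_1-z_2|_{E_T}.$$ In particular, for each $z \in E_T$ the solution $\mathcal{M}(z)\in E_T$ of the integral equation $\mathcal{M}(z)(t)=\int_0^tS(t-s)F(s,\mathcal{M}(z)(s))\,ds+z(t)$,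 $t\in[0,T]$, is unique.
   Context: $\mathcal{O}\subset\mathbb{R}^d$ is open, bounded, with smooth boundary; $r\in\mathbb{N}$ is fixed. $\tilde E=\{y\in C(\bar{\mathcal{O}}): y=0 \text{ on }\partial\mathcal{O}\}$ with the supremum norm. $E=\{x\in C(\bar{\mathcal{O}}\times\{1,\dots,r\}): x_i=0\text{ on }\partial\mathcal{O}\ \forall i\}$ with $|x|_E=\sup_i\sup_\xi|x_i(\xi)|$. $E_T=\{\varphi\in C([0,T]\times\bar{\mathcal{O}}\times\{1,\dots,r\}):\varphi_i(t,\xi)=0\text{ for }\xi\in\partial\mathcal{O}\}$ with $|\varphi|_{E_T}=\sup_{i,\xi,t}|\varphi_i(t,\xi)|$. For $i\in\{1,\dots,r\}$, $\mathcal{A}_i\varphi=\sum_{j,k=1}^d a^i_{jk}\frac{\partial^2\varphi}{\partial\xi_j\partial\xi_k}+\sum_{j=1}^d b^i_j\frac{\partial\varphi}{\partial\xi_j}$ with $a^i_{jk}\in C^1(\bar{\mathcal{O}})$, $b^i_j\in C(\bar{\mathcal{O}})$, $(a^i_{jk})$ symmetric, and for some $\kappa>0$, $\sum_{j,k}a^i_{jk}(\xi)y_jy_k\ge\kappa|y|^2$ for all $i$, $\xi\in\mathcal{O}$, $y\in\mathbb{R}^d$. $S_i(t)$ is the $C_0$ contraction semigroup on $\tilde E$ generated by $\mathcal{A}_i$ with zero Dirichlet boundary conditions, and $[S(t)x]_i=S_i(t)x_i$ for $x\in E$. $F$ is the Nemytskii operator $[F(t,x)]_i(\xi)=f_i(t,\xi,x(\xi))$.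 Convention: $f$ is such that $F:[0,\infty)\times E\to E$ and $F(\cdot,\varphi(\cdot))\in E_T$ for all $\varphi\in E_T$. A solution $\mathcal{M}(z)\in E_T$ of the integral equation $\mathcal{M}(z)(t)=\int_0^tS(t-s)F(s,\mathcal{M}(z)(s))\,ds+z(t)$, $t\in[0,T]$, is known to exist for every $z\in E_T$. *)

theory Defs
  imports "HOL-Analysis.Analysis"
begin

section \<open>Smoothness and domains with smooth boundary\<close>

definition partial :: "'d::finite \<Rightarrow> (real^'d \<Rightarrow> real) \<Rightarrow> real^'d \<Rightarrow> real" where
  "partial j \<phi> \<xi> = frechet_derivative \<phi> (at \<xi>) (axis j 1)"

text \<open>\<open>Ck_on n U \<phi>\<close>, for open \<open>U\<close>: the function is \<open>n\<close> times continuously differentiable on \<open>U\<close>.\<close>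

fun Ck_on :: "nat \<Rightarrow> (real^'d::finite) set \<Rightarrow> (real^'d \<Rightarrow> real) \<Rightarrow> bool" where
  "Ck_on 0 U \<phi> \<longleftrightarrow> continuous_on U \<phi>"
| "Ck_on (Suc n) U \<phi> \<longleftrightarrow>
     (\<forall>\<xi>\<in>U. \<phi> differentiable (at \<xi>)) \<and> (\<forall>j. Ck_on n U (partial j \<phi>))"

definition smooth_on :: "(real^'d::finite) set \<Rightarrow> (real^'d \<Rightarrow> real) \<Rightarrow> bool" where
  "smooth_on U \<phi> \<longleftrightarrow> (\<forall>n. Ck_on n U \<phi>)"

text \<open>Near each boundary point the domain is the sublevel set of a smooth function with
  nonvanishing gradient; by the implicit function theorem, the boundary is then locally the graph
  of a smooth function and the domain lies on one side of it.\<close>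

definition smooth_boundary :: "(real^'d::finite) set \<Rightarrow> bool" where
  "smooth_boundary \<Omega> \<longleftrightarrow>
     (\<forall>p\<in>frontier \<Omega>. \<exists>U \<rho>. open U \<and> p \<in> U \<and> smooth_on U \<rho> \<and>
        (\<forall>\<xi>\<in>U. \<exists>j. partial j \<rho> \<xi> \<noteq> 0) \<and> \<Omega> \<inter> U = {\<xi>\<in>U. \<rho> \<xi> < 0})"

text \<open>\<open>C\<^sup>1\<close> up to the boundary: the gradient on \<open>\<Omega>\<close> extends continuously to the closure.\<close>

definition C1_closure :: "(real^'d::finite) set \<Rightarrow> (real^'d \<Rightarrow> real) \<Rightarrow> bool" where
  "C1_closure \<Omega> \<phi> \<longleftrightarrow> continuous_on (closure \<Omega>) \<phi> \<and>
     (\<exists>G. continuous_on (closure \<Omega>) G \<and> (\<forall>\<xi>\<in>\<Omega>. (\<phi> has_derivative (\<lambda>y. G \<xi> \<bullet> y)) (at \<xi>)))"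


section \<open>The function spaces\<close>

text \<open>A continuous function on \<open>closure \<Omega>\<close> that vanishes on \<open>frontier \<Omega>\<close> is represented by its
  extension by zero to the whole space, which is continuous. The norm of bounded continuous
  functions is then the supremum norm over \<open>closure \<Omega>\<close>.\<close>

definition Et_space :: "(real^'d::finite) set \<Rightarrow> ((real^'d) \<Rightarrow>\<^sub>C real) set" where
  "Et_space \<Omega> = {x. \<forall>\<xi>. \<xi> \<notin> \<Omega> \<longrightarrow> apply_bcontfun x \<xi> = 0}"

text \<open>\<open>E\<close>: the index \<open>{1,\<dots>,r}\<close> is the finite type \<open>'r\<close>. The library norm on the type
  \<open>((real^'d) \<Rightarrow>\<^sub>C real)^'r\<close> is the Euclidean combination of the component
  norms. It is equivalent to the supremum norm of \<open>E\<close>, but not equal to it, so the latter is defined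
  separately.\<close>

definition E_space :: "(real^'d::finite) set \<Rightarrow> (((real^'d) \<Rightarrow>\<^sub>C real)^'r::finite) set" where
  "E_space \<Omega> = {x. \<forall>i. x $ i \<in> Et_space \<Omega>}"

definition E_norm :: "((real^'d) \<Rightarrow>\<^sub>C real)^'r::finite \<Rightarrow> real" where
  "E_norm x = (SUP i. norm (x $ i))"

text \<open>\<open>E\<^sub>T\<close>: the functions on \<open>[0,T]\<close> (extensional, so that equality is equality on \<open>[0,T]\<close>) that are
  jointly continuous in \<open>(t, \<xi>)\<close>.\<close>

definition ET_space ::
  "(real^'d::finite) set \<Rightarrow> real \<Rightarrow> (real \<Rightarrow> ((real^'d) \<Rightarrow>\<^sub>C real)^'r::finite) set" where
  "ET_space \<Omega> T = {\<phi> \<in> {0..T} \<rightarrow>\<^sub>E E_space \<Omega>.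
     \<forall>i. continuous_on ({0..T} \<times> closure \<Omega>) (\<lambda>(t, \<xi>). apply_bcontfun (\<phi> t $ i) \<xi>)}"

definition ET_norm :: "real \<Rightarrow> (real \<Rightarrow> ((real^'d) \<Rightarrow>\<^sub>C real)^'r::finite) \<Rightarrow> real" where
  "ET_norm T \<phi> = (SUP t\<in>{0..T}. E_norm (\<phi> t))"


section \<open>The elliptic operators with zero Dirichlet boundary conditions\<close>

definition test_function :: "(real^'d::finite) set \<Rightarrow> (real^'d \<Rightarrow> real) \<Rightarrow> bool" where
  "test_function \<Omega> \<phi> \<longleftrightarrow> smooth_on UNIV \<phi> \<and>
     compact (closure {\<xi>. \<phi> \<xi> \<noteq> 0}) \<and> closure {\<xi>. \<phi> \<xi> \<noteq> 0} \<subseteq> \<Omega>"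

definition Lp_on :: "(real^'d::finite) set \<Rightarrow> real \<Rightarrow> (real^'d \<Rightarrow> real) \<Rightarrow> bool" where
  "Lp_on \<Omega> p u \<longleftrightarrow> set_borel_measurable lebesgue \<Omega> u \<and>
     set_integrable lebesgue \<Omega> (\<lambda>\<xi>. \<bar>u \<xi>\<bar> powr p)"

definition has_weak_partial ::
  "(real^'d::finite) set \<Rightarrow> 'd \<Rightarrow> (real^'d \<Rightarrow> real) \<Rightarrow> (real^'d \<Rightarrow> real) \<Rightarrow> bool" where
  "has_weak_partial \<Omega> j u v \<longleftrightarrow> (\<forall>\<phi>. test_function \<Omega> \<phi> \<longrightarrow>
     (LINT \<xi>:\<Omega>|lebesgue. u \<xi> * partial j \<phi> \<xi>) = - (LINT \<xi>:\<Omega>|lebesgue. v \<xi> * \<phi> \<xi>))"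

text \<open>Graph of the realization in \<open>Et_space \<Omega>\<close> of the operator with second-order coefficients \<open>a\<close> and
  first-order coefficients \<open>b\<close>, with zero Dirichlet boundary conditions. As usual for such operators
  in spaces of continuous functions, its domain consists of the \<open>u\<close> in \<open>Et_space \<Omega>\<close> that belong to
  \<open>W\<^bsup>2,p\<^esup>(\<Omega>)\<close> for all finite \<open>p\<close> and whose image under the operator is again in \<open>Et_space \<Omega>\<close>
  (the domain cannot be taken inside \<open>C\<^sup>2\<close> when the dimension exceeds one). Here \<open>Du\<close> and \<open>D2u\<close>
  are the first and second weak derivatives of \<open>u\<close>.\<close>

definition dirichlet_realization ::
  "(real^'d::finite) set \<Rightarrow> ('d \<Rightarrow> 'd \<Rightarrow> real^'d \<Rightarrow> real) \<Rightarrow> ('d \<Rightarrow> real^'d \<Rightarrow> real) \<Rightarrow>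
   (((real^'d) \<Rightarrow>\<^sub>C real) \<times> ((real^'d) \<Rightarrow>\<^sub>C real)) set" where
  "dirichlet_realization \<Omega> a b = {(u, v). u \<in> Et_space \<Omega> \<and> v \<in> Et_space \<Omega> \<and>
     (\<exists>Du D2u.
        (\<forall>j. has_weak_partial \<Omega> j (apply_bcontfun u) (Du j)) \<and>
        (\<forall>j k. has_weak_partial \<Omega> k (Du j) (D2u j k)) \<and>
        (\<forall>p\<ge>1. Lp_on \<Omega> p (apply_bcontfun u) \<and> (\<forall>j. Lp_on \<Omega> p (Du j)) \<and>
                (\<forall>j k. Lp_on \<Omega> p (D2u j k))) \<and>
        (AE \<xi> in lebesgue. \<xi> \<in> \<Omega> \<longrightarrow>
           apply_bcontfun v \<xi> =
             (\<Sum>j\<in>UNIV. \<Sum>k\<in>UNIV. a j k \<xi> * D2u j k \<xi>) + (\<Sum>j\<in>UNIV. b j \<xi> * Du j \<xi>)))}"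


section \<open>Semigroups on a linear subspace of a normed space\<close>

definition C0_contraction_semigroup ::
  "'a::real_normed_vector set \<Rightarrow> (real \<Rightarrow> 'a \<Rightarrow> 'a) \<Rightarrow> bool" where
  "C0_contraction_semigroup X S \<longleftrightarrow>
     (\<forall>t\<ge>0. \<forall>x\<in>X. S t x \<in> X \<and> norm (S t x) \<le> norm x) \<and>
     (\<forall>t\<ge>0. \<forall>x\<in>X. \<forall>y\<in>X. S t (x + y) = S t x + S t y) \<and>
     (\<forall>t\<ge>0. \<forall>c. \<forall>x\<in>X. S t (c *\<^sub>R x) = c *\<^sub>R S t x) \<and>
     (\<forall>x\<in>X. S 0 x = x) \<and>
     (\<forall>s\<ge>0. \<forall>t\<ge>0. \<forall>x\<in>X. S (s + t) x = S s (S t x)) \<and>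
     (\<forall>x\<in>X. ((\<lambda>t. S t x) \<longlongrightarrow> x) (at_right 0))"

definition generator_graph ::
  "'a::real_normed_vector set \<Rightarrow> (real \<Rightarrow> 'a \<Rightarrow> 'a) \<Rightarrow> ('a \<times> 'a) set" where
  "generator_graph X S =
     {(x, y). x \<in> X \<and> y \<in> X \<and> ((\<lambda>t. (1 / t) *\<^sub>R (S t x - x)) \<longlongrightarrow> y) (at_right 0)}"

definition diag_semigroup ::
  "('r::finite \<Rightarrow> real \<Rightarrow> 'a \<Rightarrow> 'a) \<Rightarrow> real \<Rightarrow> 'a^'r \<Rightarrow> 'a^'r" where
  "diag_semigroup S t x = (\<chi> i. S i t (x $ i))"


section \<open>Nemytskii operator and the integral equation\<close>

text \<open>\<open>nemytskii_fun\<close> is the function \<open>\<xi> \<mapsto> f\<^sub>i(t, \<xi>, x(\<xi>))\<close> on \<open>\<Omega>\<close>, extended by zero. \<open>Bcontfun\<close> is only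
  meaningful on bounded continuous functions; see \<open>F_maps_E\<close> below.\<close>

definition nemytskii_fun ::
  "(real^'d::finite) set \<Rightarrow> ('r::finite \<Rightarrow> real \<Rightarrow> real^'d \<Rightarrow> real^'r \<Rightarrow> real) \<Rightarrow>
   real \<Rightarrow> ((real^'d) \<Rightarrow>\<^sub>C real)^'r \<Rightarrow> 'r \<Rightarrow> real^'d \<Rightarrow> real" where
  "nemytskii_fun \<Omega> f t x i \<xi> =
     (if \<xi> \<in> \<Omega> then f i t \<xi> (\<chi> k. apply_bcontfun (x $ k) \<xi>) else 0)"

definition nemytskii ::
  "(real^'d::finite) set \<Rightarrow> ('r::finite \<Rightarrow> real \<Rightarrow> real^'d \<Rightarrow> real^'r \<Rightarrow> real) \<Rightarrow>
   real \<Rightarrow> ((real^'d) \<Rightarrow>\<^sub>C real)^'r \<Rightarrow> ((real^'d) \<Rightarrow>\<^sub>C real)^'r" where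
  "nemytskii \<Omega> f t x = (\<chi> i. Bcontfun (nemytskii_fun \<Omega> f t x i))"

definition is_solution ::
  "(real^'d::finite) set \<Rightarrow> ('r::finite \<Rightarrow> real \<Rightarrow> ((real^'d) \<Rightarrow>\<^sub>C real) \<Rightarrow> ((real^'d) \<Rightarrow>\<^sub>C real)) \<Rightarrow>
   ('r \<Rightarrow> real \<Rightarrow> real^'d \<Rightarrow> real^'r \<Rightarrow> real) \<Rightarrow> real \<Rightarrow>
   (real \<Rightarrow> ((real^'d) \<Rightarrow>\<^sub>C real)^'r) \<Rightarrow> (real \<Rightarrow> ((real^'d) \<Rightarrow>\<^sub>C real)^'r) \<Rightarrow> bool" where
  "is_solution \<Omega> S f T z w \<longleftrightarrow> w \<in> ET_space \<Omega> T \<and>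
     (\<forall>t\<in>{0..T}.
        w t = integral {0..t} (\<lambda>s. diag_semigroup S (t - s) (nemytskii \<Omega> f s (w s))) + z t)"


section \<open>Standing assumptions\<close>

locale reaction_diffusion_system =
  fixes \<Omega> :: "(real^'d::finite) set"
    and \<kappa> :: real
    and a :: "'r::finite \<Rightarrow> 'd \<Rightarrow> 'd \<Rightarrow> real^'d \<Rightarrow> real"
    and b :: "'r \<Rightarrow> 'd \<Rightarrow> real^'d \<Rightarrow> real"
    and S :: "'r \<Rightarrow> real \<Rightarrow> ((real^'d) \<Rightarrow>\<^sub>C real) \<Rightarrow> ((real^'d) \<Rightarrow>\<^sub>C real)"
    and f :: "'r \<Rightarrow> real \<Rightarrow> real^'d \<Rightarrow> real^'r \<Rightarrow> real"
    and g :: "'r \<Rightarrow> real \<Rightarrow> real^'d \<Rightarrow> real \<Rightarrow> real"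
    and h :: "'r \<Rightarrow> real \<Rightarrow> real^'d \<Rightarrow> real^'r \<Rightarrow> real"
    and L :: "real \<Rightarrow> real"
  assumes domain: "open \<Omega>" "bounded \<Omega>" "smooth_boundary \<Omega>"
    and a_C1: "C1_closure \<Omega> (a i j k)"
    and a_sym: "\<xi> \<in> closure \<Omega> \<Longrightarrow> a i j k \<xi> = a i k j \<xi>"
    and b_cont: "continuous_on (closure \<Omega>) (b i j)"
    and \<kappa>_pos: "\<kappa> > 0"
    and elliptic: "\<xi> \<in> \<Omega> \<Longrightarrow> (\<Sum>j\<in>UNIV. \<Sum>k\<in>UNIV. a i j k \<xi> * y $ j * y $ k) \<ge> \<kappa> * (norm y)\<^sup>2"
    and semigroup: "C0_contraction_semigroup (Et_space \<Omega>) (S i)"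
    and generator: "generator_graph (Et_space \<Omega>) (S i) = dirichlet_realization \<Omega> (a i) (b i)"
    and F_maps_E: "\<lbrakk>t \<ge> 0; x \<in> E_space \<Omega>\<rbrakk> \<Longrightarrow> nemytskii_fun \<Omega> f t x i \<in> bcontfun"
    and F_maps_ET: "\<lbrakk>T > 0; \<phi> \<in> ET_space \<Omega> T\<rbrakk> \<Longrightarrow>
          (\<lambda>t\<in>{0..T}. nemytskii \<Omega> f t (\<phi> t)) \<in> ET_space \<Omega> T"
    and f_split: "\<lbrakk>t \<ge> 0; \<xi> \<in> \<Omega>\<rbrakk> \<Longrightarrow> f i t \<xi> u = g i t \<xi> (u $ i) + h i t \<xi> u"
    and g_cont: "\<lbrakk>t \<ge> 0; \<xi> \<in> \<Omega>\<rbrakk> \<Longrightarrow> continuous_on UNIV (g i t \<xi>)"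
    and g_antimono: "\<lbrakk>t \<ge> 0; \<xi> \<in> \<Omega>\<rbrakk> \<Longrightarrow> antimono (g i t \<xi>)"
    and L_nonneg: "t \<ge> 0 \<Longrightarrow> L t \<ge> 0"
    and L_mono: "mono_on {0..} L"
    and h_lipschitz: "\<lbrakk>t \<ge> 0; s \<in> {0..t}; \<xi> \<in> \<Omega>\<rbrakk> \<Longrightarrow>
          \<bar>h i s \<xi> u - h i s \<xi> v\<bar> \<le> L t * (SUP k. \<bar>u $ k - v $ k\<bar>)"
    and h_growth: "\<lbrakk>t \<ge> 0; s \<in> {0..t}; \<xi> \<in> \<Omega>\<rbrakk> \<Longrightarrow>
          \<bar>h i s \<xi> u\<bar> \<le> L t * (1 + (SUP k. \<bar>u $ k\<bar>))"

end

theory Submission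
  imports Defs
begin

text \<open>Let \<open>v = (w1 - w2) - (z1 - z2)\<close> for two solutions and \<open>\<delta> = \<bar>z1 - z2\<bar>\<close>, so that \<open>v\<close> is the
  convolution of \<open>S\<close> with the difference \<open>G\<close> of the two reaction terms. As \<open>S\<close> is a contraction
  semigroup, \<open>\<bar>v t - h G t\<bar> \<le> \<bar>v (t - h)\<bar> + o(h)\<close>. Evaluate this at
  a point where \<open>\<bar>v t\<bar>\<close> is attained. If \<open>\<bar>v t\<bar> > \<delta>\<close>, then \<open>w1 - w2\<close> has the sign of \<open>v\<close> there, so
  the monotone part of \<open>G\<close> only helps, and \<open>\<bar>v\<bar>\<close> has left derivative at most
  \<open>L (\<bar>v\<bar> + \<delta>) \<le> 2 L \<bar>v\<bar>\<close>. Hence \<open>\<bar>v t\<bar> \<le> \<delta> exp ((2 L + 1) t)\<close>.\<close>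

section \<open>A comparison principle for scalar functions with controlled left increments\<close>

text \<open>Weight by \<open>exp (- (K * s))\<close> and look at a maximum point \<open>m\<close> of
  the weighted function. If the maximum exceeded \<open>\<delta>\<close>, then just to the left of
  \<open>m\<close> maximality would force \<open>\<phi>\<close> to grow at relative rate about
  \<open>K\<close>, whereas \<open>step\<close> permits only a rate close to \<open>c < K\<close>.
  No differentiability of \<open>\<phi>\<close> enters.\<close>

lemma exp_growth_bound_of_left_increments:
  fixes \<phi> :: "real \<Rightarrow> real"
  assumes cont: "continuous_on {0..T} \<phi>" and \<delta>: "\<delta> \<ge> 0" and init: "\<phi> 0 \<le> \<delta>"
    and c: "0 \<le> c" "c < K"
    and step: "\<And>t e. \<lbrakk>0 < t; t \<le> T; \<delta> < \<phi> t; 0 < e\<rbrakk> \<Longrightarrow>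
        \<forall>\<^sub>F h in at_right 0. \<phi> t \<le> \<phi> (t - h) + h * (c * \<phi> t + e)"
    and t: "t \<in> {0..T}"
  shows "\<phi> t \<le> \<delta> * exp (K * t)"
proof -
  define u where "u s = \<phi> s * exp (- (K * s))" for s
  have "continuous_on {0..T} u"
    unfolding u_def by (intro continuous_intros cont)
  then obtain m where m: "m \<in> {0..T}" and max: "\<And>s. s \<in> {0..T} \<Longrightarrow> u s \<le> u m"
    using continuous_attains_sup[of "{0..T}" u] t by auto
  have "u m \<le> \<delta>"
  proof (rule ccontr)
    assume "\<not> u m \<le> \<delta>"
    then have um: "\<delta> < u m" by simp
    then have pos: "0 < \<phi> m"
      using \<delta> unfolding u_def by (smt (verit) exp_gt_zero mult_nonpos_nonneg)
    have "u m \<le> \<phi> m"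
      using pos m c by (simp add: u_def)
    then have big: "\<delta> < \<phi> m" using um by simp
    have "m \<noteq> 0" using um init by (auto simp: u_def)
    then have m0: "0 < m" using m by simp
    \<comment> \<open>With this \<open>e\<close> the rate \<open>c * \<phi> m + e\<close> allowed by
      \<open>step\<close> equals \<open>\<phi> m * ((K + c) / 2)\<close>, halfway between the two
      competing rates.\<close>
    define e where "e = (K - c) * \<phi> m / 2"
    have e: "0 < e" using pos c by (simp add: e_def)
    have "\<forall>\<^sub>F h in at_right 0. h < m"
      using m0 by (auto simp: eventually_at_right)
    \<comment> \<open>The quotient \<open>K / (1 + K * h)\<close> is the relative growth rate forced
      by maximality at \<open>m\<close>; as \<open>h\<close> tends to 0 it exceeds the midpoint of
      \<open>c\<close> and \<open>K\<close>.\<close>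
    moreover have "((\<lambda>h. K / (1 + K * h)) \<longlongrightarrow> K / (1 + K * 0)) (at_right 0)"
      by (intro tendsto_intros) auto
    then have "\<forall>\<^sub>F h in at_right 0. (K + c) / 2 < K / (1 + K * h)"
      by (rule order_tendstoD) (use c in auto)
    moreover have "\<forall>\<^sub>F h::real in at_right 0. 0 < h"
      by (rule eventually_at_right_less)
    moreover have "\<forall>\<^sub>F h in at_right 0. \<phi> m \<le> \<phi> (m - h) + h * (c * \<phi> m + e)"
      using step[OF m0 _ big e] m by auto
    ultimately have "\<forall>\<^sub>F h::real in at_right 0. False"
    proof eventually_elim
      case (elim h)
      have "u (m - h) \<le> u m"
        using max[of "m - h"] elim m by auto
      moreover have "exp (- (K * (m - h))) = exp (K * h) * exp (- (K * m))"
        by (simp add: algebra_simps flip: exp_add)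
      ultimately have "\<phi> (m - h) * exp (K * h) * exp (- (K * m)) \<le> \<phi> m * exp (- (K * m))"
        by (simp add: u_def mult.assoc)
      then have A: "\<phi> (m - h) * exp (K * h) \<le> \<phi> m" by simp
      have B: "1 + K * h \<le> exp (K * h)" by (rule exp_ge_add_one_self)
      have q: "0 < 1 + K * h" using c elim by (simp add: add_pos_nonneg)
      have C: "\<phi> (m - h) \<le> \<phi> m / (1 + K * h)"
      \<comment> \<open>\<open>B\<close> may be multiplied by \<open>\<phi> (m - h)\<close> only if
        that value is nonnegative; otherwise the bound holds because its right side is
        positive.\<close>
      proof (cases "0 \<le> \<phi> (m - h)")
        case True
        then have "\<phi> (m - h) * (1 + K * h) \<le> \<phi> m"
          using A mult_left_mono[OF B True] by linarith
        then show ?thesis using q by (simp add: pos_le_divide_eq)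
      next
        case False
        then show ?thesis using pos q by (meson divide_nonneg_pos le_cases less_imp_le order_trans)
      qed
      have "\<phi> m - \<phi> m / (1 + K * h) = h * \<phi> m * (K / (1 + K * h))"
        using q by (simp add: field_simps)
      also have "\<dots> > h * \<phi> m * ((K + c) / 2)"
        using elim pos by (intro mult_strict_left_mono) auto
      finally have "h * \<phi> m * ((K + c) / 2) < h * (c * \<phi> m + e)"
        using C elim by linarith
      moreover have "c * \<phi> m + e = \<phi> m * ((K + c) / 2)"
        by (simp add: e_def field_simps)
      ultimately show False by (simp add: mult.assoc)
    qed
    then show False by simp
  qed
  then have "u t \<le> \<delta>" using max[OF t] by simp
  then have "u t * exp (K * t) \<le> \<delta> * exp (K * t)" by simp
  then show ?thesis by (simp add: u_def mult.assoc flip: exp_add)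
qed

section \<open>Vector-valued integrals inside a subspace\<close>

text \<open>Every tagged Riemann sum is a linear combination of values in \<open>X\<close>, and
  \<open>y\<close> is a limit of such sums.\<close>

lemma has_integral_mem_closed_subspace:
  fixes f :: "real \<Rightarrow> 'a::real_normed_vector"
  assumes f: "(f has_integral y) {a..b}" and X: "subspace X" "closed X"
    and mem: "\<And>s. s \<in> {a..b} \<Longrightarrow> f s \<in> X"
  shows "y \<in> X"
proof -
  have "\<exists>x\<in>X. dist x y < e" if e: "e > 0" for e
  proof -
    obtain \<gamma> where \<gamma>: "gauge \<gamma>" and
      close: "\<forall>\<D>. \<D> tagged_division_of {a..b} \<and> \<gamma> fine \<D> \<longrightarrow>
        norm ((\<Sum>(x,k)\<in>\<D>. measure lborel k *\<^sub>R f x) - y) < e"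
      using f[unfolded has_integral_real, rule_format, OF e] by blast
    obtain \<D> where \<D>: "\<D> tagged_division_of {a..b}" "\<gamma> fine \<D>"
      using fine_division_exists_real[OF \<gamma>] by blast
    have "f x \<in> X" if "(x, k) \<in> \<D>" for x k
      using tag_in_interval[OF \<D>(1) that] by (rule mem)
    then have "(\<Sum>(x,k)\<in>\<D>. measure lborel k *\<^sub>R f x) \<in> X"
      by (intro subspace_sum[OF X(1)]) (auto intro: subspace_scale[OF X(1)])
    moreover have "norm ((\<Sum>(x,k)\<in>\<D>. measure lborel k *\<^sub>R f x) - y) < e"
      using close \<D> by blast
    ultimately show ?thesis
      unfolding dist_norm by blast
  qed
  then have "y \<in> closure X" by (simp add: closure_approachable)
  then show ?thesis using X by simp
qed

text \<open>\<open>A\<close> is linear and nonexpansive only on \<open>X\<close>, so it need not be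
  a bounded linear map of the whole type. It still commutes with the Riemann sums, which lie in
  \<open>X\<close>, and since it does not enlarge the error \<open>sum - y\<close>, the gauge for
  \<open>f\<close> serves for \<open>A\<close> as well.\<close>

lemma has_integral_linear_on_subspace:
  fixes f :: "real \<Rightarrow> 'a::real_normed_vector" and A :: "'a \<Rightarrow> 'b::real_normed_vector"
  assumes f: "(f has_integral y) {a..b}" and X: "subspace X" and y: "y \<in> X"
    and mem: "\<And>s. s \<in> {a..b} \<Longrightarrow> f s \<in> X"
    and add: "\<And>u v. u \<in> X \<Longrightarrow> v \<in> X \<Longrightarrow> A (u + v) = A u + A v"
    and scale: "\<And>c u. u \<in> X \<Longrightarrow> A (c *\<^sub>R u) = c *\<^sub>R A u"
    and bound: "\<And>u. u \<in> X \<Longrightarrow> norm (A u) \<le> norm u"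
  shows "((\<lambda>s. A (f s)) has_integral A y) {a..b}"
  unfolding has_integral_real
proof (intro allI impI)
  fix e :: real assume e: "e > 0"
  have A0: "A 0 = 0"
    using scale[of 0 0] subspace_0[OF X] by simp
  have A_sum: "A (\<Sum>p\<in>D. F p) = (\<Sum>p\<in>D. A (F p))" if "finite D" "\<And>p. p \<in> D \<Longrightarrow> F p \<in> X"
    for D :: "(real \<times> real set) set" and F
    using that by (induction D rule: finite_induct) (auto simp: A0 add subspace_sum[OF X])
  have A_diff: "A (u - v) = A u - A v" if "u \<in> X" "v \<in> X" for u v
    using add[OF that(1), of "(-1) *\<^sub>R v"] scale[OF that(2), of "-1"] that X
    by (simp add: subspace_neg)
  obtain \<gamma> where \<gamma>: "gauge \<gamma>" and
    close: "\<forall>\<D>. \<D> tagged_division_of {a..b} \<and> \<gamma> fine \<D> \<longrightarrow>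
      norm ((\<Sum>(x,k)\<in>\<D>. measure lborel k *\<^sub>R f x) - y) < e"
    using f[unfolded has_integral_real, rule_format, OF e] by blast
  have "norm ((\<Sum>(x,k)\<in>\<D>. measure lborel k *\<^sub>R A (f x)) - A y) < e"
    if \<D>: "\<D> tagged_division_of {a..b}" "\<gamma> fine \<D>" for \<D>
  proof -
    let ?F = "\<lambda>(x,k). measure lborel k *\<^sub>R f x"
    have tag: "f x \<in> X" if "(x, k) \<in> \<D>" for x k
      using tag_in_interval[OF \<D>(1) that] by (rule mem)
    have F: "?F p \<in> X" if "p \<in> \<D>" for p
      using tag that by (cases p) (simp add: subspace_scale[OF X])
    have "A (sum ?F \<D>) = (\<Sum>p\<in>\<D>. A (?F p))"
      using A_sum[of \<D> ?F] F \<D>(1) by blast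
    also have "\<dots> = (\<Sum>(x,k)\<in>\<D>. measure lborel k *\<^sub>R A (f x))"
      using tag by (intro sum.cong) (auto simp: scale)
    finally have "(\<Sum>(x,k)\<in>\<D>. measure lborel k *\<^sub>R A (f x)) - A y = A (sum ?F \<D> - y)"
      by (simp only: A_diff[OF subspace_sum[OF X F] y])
    also have "norm \<dots> \<le> norm (sum ?F \<D> - y)"
      by (intro bound subspace_diff[OF X] subspace_sum[OF X] F y)
    also have "\<dots> < e" using close \<D> by blast
    finally show ?thesis .
  qed
  then show "\<exists>\<gamma>. gauge \<gamma> \<and> (\<forall>\<D>. \<D> tagged_division_of {a..b} \<and> \<gamma> fine \<D> \<longrightarrow>
      norm ((\<Sum>(x,k)\<in>\<D>. measure lborel k *\<^sub>R A (f x)) - A y) < e)"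
    using \<gamma> by blast
qed


section \<open>Contraction semigroups on a subspace and their convolutions\<close>

lemma C0_contraction_semigroupD:
  assumes "C0_contraction_semigroup X S"
  shows "\<lbrakk>t \<ge> 0; x \<in> X\<rbrakk> \<Longrightarrow> S t x \<in> X"
    and "\<lbrakk>t \<ge> 0; x \<in> X\<rbrakk> \<Longrightarrow> norm (S t x) \<le> norm x"
    and "\<lbrakk>t \<ge> 0; x \<in> X; y \<in> X\<rbrakk> \<Longrightarrow> S t (x + y) = S t x + S t y"
    and "\<lbrakk>t \<ge> 0; x \<in> X\<rbrakk> \<Longrightarrow> S t (c *\<^sub>R x) = c *\<^sub>R S t x"
    and "x \<in> X \<Longrightarrow> S 0 x = x"
    and "\<lbrakk>s \<ge> 0; t \<ge> 0; x \<in> X\<rbrakk> \<Longrightarrow> S (s + t) x = S s (S t x)"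
    and "x \<in> X \<Longrightarrow> ((\<lambda>t. S t x) \<longlongrightarrow> x) (at_right 0)"
  using assms unfolding C0_contraction_semigroup_def by blast+

lemma semigroup_diff:
  fixes S :: "real \<Rightarrow> 'a::real_normed_vector \<Rightarrow> 'a"
  assumes S: "C0_contraction_semigroup X S" and X: "subspace X"
    and t: "t \<ge> 0" and u: "u \<in> X" and v: "v \<in> X"
  shows "S t (u - v) = S t u - S t v"
proof -
  have "(-1) *\<^sub>R v \<in> X" using X v by (rule subspace_scale)
  then have "S t (u + (-1) *\<^sub>R v) = S t u + (-1) *\<^sub>R S t v"
    by (simp only: C0_contraction_semigroupD(3,4)[OF S] t u v)
  then show ?thesis by simp
qed

text \<open>By the semigroup law and contractivity, an increment of length \<open>h\<close> from any
  base point is at most the increment from time 0. The bound does not depend on the base point, so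
  right continuity at 0 gives continuity from both sides.\<close>

lemma semigroup_orbit_continuous:
  fixes S :: "real \<Rightarrow> 'a::real_normed_vector \<Rightarrow> 'a"
  assumes S: "C0_contraction_semigroup X S" and X: "subspace X" and x: "x \<in> X"
  shows "continuous_on {0..} (\<lambda>t. S t x)"
proof -
  have incr: "norm (S (s + h) x - S s x) \<le> norm (S h x - x)" if "s \<ge> 0" "h \<ge> 0" for s h
  proof -
    have hx: "S h x \<in> X"
      using that x by (intro C0_contraction_semigroupD(1)[OF S])
    have "S (s + h) x - S s x = S s (S h x - x)"
      by (simp only: C0_contraction_semigroupD(6)[OF S] semigroup_diff[OF S X] that x hx)
    then show ?thesis
      using C0_contraction_semigroupD(2)[OF S that(1) subspace_diff[OF X hx x]] by simp
  qed
  show ?thesis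
    unfolding continuous_on_iff
  proof (intro ballI allI impI)
    fix t e :: real assume t: "t \<in> {0..}" and e: "e > 0"
    have "((\<lambda>h. S h x) \<longlongrightarrow> x) (at_right 0)"
      using x by (rule C0_contraction_semigroupD(7)[OF S])
    from tendstoD[OF this e] obtain d where d: "d > 0"
      and close: "\<And>h. 0 < h \<Longrightarrow> h < d \<Longrightarrow> dist (S h x) x < e"
      unfolding eventually_at_right_field by auto
    have "dist (S s x) (S t x) < e" if "s \<in> {0..}" "dist s t < d" for s
    proof (cases s t rule: linorder_cases)
      case less
      then show ?thesis
        using incr[of s "t - s"] close[of "t - s"] that t
        by (simp add: dist_norm norm_minus_commute)
    next
      case greater
      then show ?thesis
        using incr[of t "s - t"] close[of "s - t"] that t by (simp add: dist_norm)
    qed (use e in simp)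
    then show "\<exists>d>0. \<forall>s\<in>{0..}. dist s t < d \<longrightarrow> dist (S s x) (S t x) < e"
      using d by blast
  qed
qed

text \<open>Write the increment as \<open>S (t - r) (G r) - S (t - r) (G s)\<close>, controlled by
  contractivity and continuity of \<open>G\<close>, plus an increment along the orbit of the fixed
  vector \<open>G s\<close>.\<close>

lemma semigroup_convolution_continuous:
  fixes S :: "real \<Rightarrow> 'a::real_normed_vector \<Rightarrow> 'a"
  assumes S: "C0_contraction_semigroup X S" and X: "subspace X"
    and G: "continuous_on {0..t} G" "\<And>s. s \<in> {0..t} \<Longrightarrow> G s \<in> X"
  shows "continuous_on {0..t} (\<lambda>s. S (t - s) (G s))"
  unfolding continuous_on_def
proof
  fix s assume s: "s \<in> {0..t}"
  have contr: "norm (S r u - S r v) \<le> norm (u - v)" if "r \<ge> 0" "u \<in> X" "v \<in> X" for r u v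
    using C0_contraction_semigroupD(2)[OF S that(1) subspace_diff[OF X that(2,3)]]
    by (simp add: semigroup_diff[OF S X that])
  have "continuous_on {0..t} (\<lambda>r. S (t - r) (G s))"
    by (rule continuous_on_compose2[OF semigroup_orbit_continuous[OF S X G(2)[OF s]]])
      (auto intro!: continuous_intros)
  then have A: "((\<lambda>r. S (t - r) (G s)) \<longlongrightarrow> S (t - s) (G s)) (at s within {0..t})"
    using s by (auto simp: continuous_on_def)
  have "(G \<longlongrightarrow> G s) (at s within {0..t})"
    using G s by (auto simp: continuous_on_def)
  then have "((\<lambda>r. G r - G s) \<longlongrightarrow> 0) (at s within {0..t})"
    by (simp add: LIM_zero)
  then have "((\<lambda>r. S (t - r) (G r) - S (t - r) (G s)) \<longlongrightarrow> 0) (at s within {0..t})"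
  proof (rule Lim_null_comparison[OF _ tendsto_norm_zero, rotated])
    show "\<forall>\<^sub>F r in at s within {0..t}. norm (S (t - r) (G r) - S (t - r) (G s)) \<le> norm (G r - G s)"
      using contr G(2) s by (auto simp: eventually_at_filter)
  qed
  from tendsto_add[OF this A]
  show "((\<lambda>r. S (t - r) (G r)) \<longlongrightarrow> S (t - s) (G s)) (at s within {0..t})"
    by simp
qed

text \<open>Split the integral defining \<open>v t\<close> at \<open>t - h\<close>: the first part is \<open>S h (v (t - h))\<close>, the
  second is \<open>h G t + o(h)\<close>.\<close>

lemma mild_solution_left_increment:
  fixes S :: "real \<Rightarrow> 'a::banach \<Rightarrow> 'a"
  assumes S: "C0_contraction_semigroup X S" and X: "subspace X" "closed X"
    and G: "continuous_on {0..T} G" "\<And>s. s \<in> {0..T} \<Longrightarrow> G s \<in> X"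
    and v: "\<And>t. t \<in> {0..T} \<Longrightarrow> v t = integral {0..t} (\<lambda>s. S (t - s) (G s))"
    and t: "0 < t" "t \<le> T" and e: "e > 0"
  shows "\<forall>\<^sub>F h in at_right 0. norm (v t - h *\<^sub>R G t) \<le> norm (v (t - h)) + h * e"
proof -
  have S0: "S 0 (G t) = G t" using C0_contraction_semigroupD(5)[OF S] G(2)[of t] t by simp
  have cont: "continuous_on {0..r} (\<lambda>s. S (r - s) (G s))" if "r \<le> T" for r
    using that G by (intro semigroup_convolution_continuous[OF S X(1)])
      (auto intro: continuous_on_subset)
  \<comment> \<open>Continuity of the integrand at the endpoint \<open>s = t\<close>, where it
    equals \<open>G t\<close>, is the source of the \<open>h * e\<close> error.\<close>
  have "\<exists>d>0. \<forall>s\<in>{0..t}. dist s t < d \<longrightarrow> dist (S (t - s) (G s)) (S (t - t) (G t)) < e"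
    using cont[OF t(2)] t e unfolding continuous_on_iff by (auto dest!: bspec[of _ _ t])
  then obtain d where d: "d > 0"
    and close: "\<And>s. s \<in> {0..t} \<Longrightarrow> dist s t < d \<Longrightarrow> norm (S (t - s) (G s) - G t) < e"
    by (auto simp: dist_norm S0)
  have "\<forall>\<^sub>F h::real in at_right 0. 0 < h \<and> h < t \<and> h < d"
    using t d by (auto simp: eventually_at_right intro!: exI[of _ "min t d"])
  then show ?thesis
  proof eventually_elim
    case (elim h)
    let ?k = "\<lambda>s. S (t - s) (G s)"
    have int: "?k integrable_on {0..t}"
      by (intro integrable_continuous_real cont t)
    have "v t = integral {0..t-h} ?k + integral {t-h..t} ?k"
      using v[of t] t elim int by (simp add: Henstock_Kurzweil_Integration.integral_combine)
    moreover have I: "((\<lambda>s. S (t - h - s) (G s)) has_integral v (t - h)) {0..t-h}"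
      using v[of "t - h"] t elim by (simp add: integrable_integral integrable_continuous_real cont)
    have mem: "S (t - h - s) (G s) \<in> X" if "s \<in> {0..t-h}" for s
      using C0_contraction_semigroupD(1)[OF S] G(2)[of s] t elim that by simp
    \<comment> \<open>Closedness of \<open>X\<close> enters here: \<open>S h\<close> is controlled
      only on \<open>X\<close>, so the value of the integral must lie there before
      \<open>S h\<close> can be exchanged with integration.\<close>
    have vX: "v (t - h) \<in> X"
      by (rule has_integral_mem_closed_subspace[OF I X mem])
    have "integral {0..t-h} ?k = S h (v (t - h))"
    proof (rule integral_unique, rule has_integral_eq)
      show "((\<lambda>s. S h (S (t - h - s) (G s))) has_integral S h (v (t - h))) {0..t-h}"
        using elim C0_contraction_semigroupD(2-4)[OF S]
        by (intro has_integral_linear_on_subspace[OF I X(1) vX mem]) auto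
      show "S h (S (t - h - s) (G s)) = ?k s" if "s \<in> {0..t-h}" for s
        using C0_contraction_semigroupD(6)[OF S, of h "t - h - s" "G s"] G(2)[of s] t elim that
        by simp
    qed
    moreover have "norm (S h (v (t - h))) \<le> norm (v (t - h))"
      using C0_contraction_semigroupD(2)[OF S] vX elim by simp
    moreover have "norm (integral {t-h..t} ?k - h *\<^sub>R G t) \<le> h * e"
    proof -
      have int': "?k integrable_on {t-h..t}"
        by (rule integrable_subinterval_real[OF int]) (use elim in auto)
      have "integral {t-h..t} (\<lambda>s. ?k s - G t) = integral {t-h..t} ?k - h *\<^sub>R G t"
        using Henstock_Kurzweil_Integration.integral_diff[OF int' integrable_const_ivl[of "G t"]]
          elim by simp
      moreover have "norm (integral {t-h..t} (\<lambda>s. ?k s - G t)) \<le> e * (t - (t - h))"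
      proof (rule integral_bound)
        show "continuous_on {t - h..t} (\<lambda>s. ?k s - G t)"
          using continuous_on_subset[OF cont[OF t(2)], of "{t-h..t}"] elim
          by (auto intro!: continuous_intros)
        show "norm (?k s - G t) \<le> e" if "s \<in> {t-h..t}" for s
          using close[of s] that elim by (simp add: dist_norm)
      qed (use elim in simp)
      ultimately show ?thesis by (simp add: mult.commute)
    qed
    ultimately show ?case
      using norm_triangle_ineq[of "S h (v (t - h))" "integral {t-h..t} ?k - h *\<^sub>R G t"]
      by (simp add: algebra_simps)
  qed
qed


section \<open>Norms, attained maxima and continuity in the function spaces\<close>

text \<open>Completeness is what makes continuous functions with values in this type
  integrable.\<close>

instance bcontfun :: (metric_space, banach) banach ..

lemma norm_nth_le_E_norm: "norm (x $ i) \<le> E_norm x"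
  unfolding E_norm_def by (rule cSUP_upper) auto

text \<open>The index type is finite, so the supremum is a maximum; arguments about
  \<open>E_norm\<close> can then be carried out in one component.\<close>

lemma E_norm_attained:
  obtains i where "E_norm x = norm (x $ i)"
proof -
  have "E_norm x = Max (range (\<lambda>i. norm (x $ i)))"
    unfolding E_norm_def by (rule cSup_eq_Max) auto
  then have "E_norm x \<in> range (\<lambda>i. norm (x $ i))"
    using Max_in[of "range (\<lambda>i. norm (x $ i))"] by simp
  then show ?thesis using that by auto
qed

lemma E_norm_nonneg: "0 \<le> E_norm x"
  by (rule E_norm_attained[of x]) simp

lemma E_norm_le_norm: "E_norm x \<le> norm x"
  by (rule E_norm_attained[of x]) (simp add: Finite_Cartesian_Product.norm_nth_le)

lemma E_norm_triangle: "E_norm (x + y) \<le> E_norm x + E_norm y"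
proof -
  obtain i where "E_norm (x + y) = norm (x $ i + y $ i)"
    using E_norm_attained[of "x + y"] by auto
  then show ?thesis
    using norm_triangle_ineq[of "x $ i" "y $ i"] norm_nth_le_E_norm[of x i] norm_nth_le_E_norm[of y i]
    by linarith
qed

lemma E_norm_minus_commute: "E_norm (x - y) = E_norm (y - x)"
  by (simp add: E_norm_def norm_minus_commute)

lemma E_norm_eq_0_iff: "E_norm x = 0 \<longleftrightarrow> x = 0"
proof
  assume "E_norm x = 0"
  then have "norm (x $ i) \<le> 0" for i using norm_nth_le_E_norm[of x i] by simp
  then show "x = 0" by (simp add: vec_eq_iff)
next
  assume "x = 0"
  then show "E_norm x = 0" using E_norm_le_norm[of x] E_norm_nonneg[of x] by simp
qed

text \<open>\<open>E_norm\<close> is dominated by the norm of the type, so its triangle inequality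
  makes it 1-Lipschitz for that norm.\<close>

lemma continuous_on_E_norm:
  assumes "continuous_on A \<phi>"
  shows "continuous_on A (\<lambda>t. E_norm (\<phi> t))"
proof -
  have "1-lipschitz_on UNIV E_norm"
  proof (rule lipschitz_onI)
    fix x y :: "((real^'d) \<Rightarrow>\<^sub>C real)^'r"
    have "E_norm x \<le> E_norm y + norm (x - y)" "E_norm y \<le> E_norm x + norm (y - x)"
      using E_norm_triangle[of y "x - y"] E_norm_triangle[of x "y - x"]
        E_norm_le_norm[of "x - y"] E_norm_le_norm[of "y - x"] by simp_all
    then show "dist (E_norm x) (E_norm y) \<le> 1 * dist x y"
      by (simp add: dist_norm norm_minus_commute abs_le_iff)
  qed simp
  then show ?thesis
    by (rule continuous_on_compose2[OF lipschitz_on_continuous_on assms]) simp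
qed

lemma subspace_Et_space: "subspace (Et_space \<Omega>)"
  by (auto simp: subspace_def Et_space_def)

text \<open>Membership is a family of pointwise constraints with values in the closed set
  \<open>{0}\<close>. Closedness keeps the convolution integrals inside the space.\<close>

lemma closed_Et_space: "closed (Et_space \<Omega>)"
proof -
  have "Et_space \<Omega> = PiC (- \<Omega>) (\<lambda>_. {0})"
    by (auto simp: Et_space_def mem_PiC_iff Pi_iff)
  then show ?thesis by (simp add: closed_PiC)
qed

text \<open>The maximum over the compact closure is positive because \<open>x\<close> is nonzero, so
  the maximizer cannot lie outside \<Omega>. An interior point is essential, since the conditions on
  \<open>g\<close> and \<open>h\<close> are available only in \<Omega>.\<close>

lemma Et_space_norm_attained:
  assumes "bounded \<Omega>" and x: "x \<in> Et_space \<Omega>" and "x \<noteq> 0"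
  obtains \<xi> where "\<xi> \<in> \<Omega>" "\<bar>apply_bcontfun x \<xi>\<bar> = norm x"
proof -
  obtain \<eta> where "apply_bcontfun x \<eta> \<noteq> 0"
    using \<open>x \<noteq> 0\<close> by (metis bcontfun_eqI zero_bcontfun.rep_eq)
  then have \<eta>: "\<eta> \<in> \<Omega>" "\<bar>apply_bcontfun x \<eta>\<bar> > 0"
    using x by (auto simp: Et_space_def)
  have "continuous_on (closure \<Omega>) (\<lambda>\<xi>. \<bar>apply_bcontfun x \<xi>\<bar>)"
    by (intro continuous_intros) auto
  then obtain \<xi> where "\<xi> \<in> closure \<Omega>"
    and max: "\<And>y. y \<in> closure \<Omega> \<Longrightarrow> \<bar>apply_bcontfun x y\<bar> \<le> \<bar>apply_bcontfun x \<xi>\<bar>"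
    using continuous_attains_sup[of "closure \<Omega>"] \<open>bounded \<Omega>\<close> \<eta>(1)
    by (metis closure_eq_empty compact_closure empty_iff)
  have pos: "\<bar>apply_bcontfun x \<xi>\<bar> > 0"
    using max[of \<eta>] \<eta> closure_subset[of \<Omega>] by auto
  then have "\<xi> \<in> \<Omega>" using x by (auto simp: Et_space_def)
  have "norm (apply_bcontfun x y) \<le> \<bar>apply_bcontfun x \<xi>\<bar>" for y
    using max[of y] x closure_subset[of \<Omega>] by (cases "y \<in> \<Omega>") (auto simp: Et_space_def)
  then have "norm x \<le> \<bar>apply_bcontfun x \<xi>\<bar>" by (rule norm_bound)
  then show ?thesis
    using that[OF \<open>\<xi> \<in> \<Omega>\<close>] norm_bounded[of x \<xi>] by simp
qed

text \<open>Joint continuity on a compact cylinder is uniform, so nearby times give values close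
  simultaneously at all points, that is, in the supremum norm.\<close>

lemma ET_space_continuous:
  fixes \<phi> :: "real \<Rightarrow> ((real^'d::finite) \<Rightarrow>\<^sub>C real)^'r::finite"
  assumes "bounded \<Omega>" and \<phi>: "\<phi> \<in> ET_space \<Omega> T"
  shows "continuous_on {0..T} \<phi>"
proof -
  have "continuous_on {0..T} (\<lambda>t. \<phi> t $ i)" for i
    unfolding continuous_on_iff
  proof (intro ballI allI impI)
    fix t e :: real assume t: "t \<in> {0..T}" and e: "e > 0"
    let ?u = "\<lambda>(t, \<xi>). apply_bcontfun (\<phi> t $ i) \<xi>"
    have "uniformly_continuous_on ({0..T} \<times> closure \<Omega>) ?u"
      using \<phi> \<open>bounded \<Omega>\<close>
      by (intro compact_uniformly_continuous compact_Times) (auto simp: ET_space_def compact_closure)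
    \<comment> \<open>Half of \<open>e\<close> is used because passing to the supremum over all
      points yields only a weak inequality.\<close>
    then obtain d where d: "d > 0" and close:
      "\<And>p q. p \<in> {0..T} \<times> closure \<Omega> \<Longrightarrow> q \<in> {0..T} \<times> closure \<Omega> \<Longrightarrow> dist q p < d \<Longrightarrow> dist (?u q) (?u p) < e / 2"
      using e unfolding uniformly_continuous_on_def by (metis half_gt_zero)
    have "dist (\<phi> s $ i) (\<phi> t $ i) < e" if s: "s \<in> {0..T}" "dist s t < d" for s
    proof -
      have "dist (apply_bcontfun (\<phi> s $ i) \<xi>) (apply_bcontfun (\<phi> t $ i) \<xi>) \<le> e / 2" for \<xi>
      proof (cases "\<xi> \<in> \<Omega>")
        case True
        then have "\<xi> \<in> closure \<Omega>" using closure_subset by auto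
        then show ?thesis
          using close[of "(t, \<xi>)" "(s, \<xi>)"] s t by (simp add: dist_Pair_Pair)
      next
        case False
        have "\<phi> s \<in> E_space \<Omega>" "\<phi> t \<in> E_space \<Omega>"
          using \<phi> s(1) t by (auto simp: ET_space_def PiE_iff)
        then show ?thesis
          using False e by (simp add: E_space_def Et_space_def)
      qed
      then have "dist (\<phi> s $ i) (\<phi> t $ i) \<le> e / 2" by (rule dist_bound)
      then show ?thesis using e by simp
    qed
    then show "\<exists>d>0. \<forall>s\<in>{0..T}. dist s t < d \<longrightarrow> dist (\<phi> s $ i) (\<phi> t $ i) < e"
      using d by blast
  qed
  then have "continuous_on {0..T} (\<lambda>t. \<chi> i. \<phi> t $ i)"
    by (rule continuous_on_vec_lambda)
  then show ?thesis by simp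
qed

lemma ET_space_mem: "\<phi> \<in> ET_space \<Omega> T \<Longrightarrow> t \<in> {0..T} \<Longrightarrow> \<phi> t \<in> E_space \<Omega>"
  by (auto simp: ET_space_def PiE_iff)

text \<open>Continuity on a compact interval bounds the range from above; a real \<open>SUP\<close>
  is guaranteed to be an upper bound only for such ranges.\<close>

lemma E_norm_le_ET_norm:
  assumes "continuous_on {0..T} \<phi>" "t \<in> {0..T}"
  shows "E_norm (\<phi> t) \<le> ET_norm T \<phi>"
proof -
  have "compact ((\<lambda>t. E_norm (\<phi> t)) ` {0..T})"
    by (intro compact_continuous_image continuous_on_E_norm assms) simp
  then show ?thesis
    unfolding ET_norm_def using assms(2)
    by (intro cSUP_upper bounded_imp_bdd_above compact_imp_bounded)
qed

section \<open>Estimates for the reaction term and for solutions\<close>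

context reaction_diffusion_system
begin

lemma nemytskii_apply:
  assumes "t \<ge> 0" "u \<in> E_space \<Omega>" "\<xi> \<in> \<Omega>"
  shows "apply_bcontfun (nemytskii \<Omega> f t u $ i) \<xi> =
    g i t \<xi> (apply_bcontfun (u $ i) \<xi>) + h i t \<xi> (\<chi> k. apply_bcontfun (u $ k) \<xi>)"
  using F_maps_E[OF assms(1,2), of i] f_split[OF assms(1,3)] assms(3)
  by (simp add: nemytskii_def Bcontfun_inverse nemytskii_fun_def)

text \<open>Since \<open>g i\<close> sees only component \<open>i\<close>, the order of that single
  component at \<xi> makes the contribution of \<open>g\<close> nonpositive. What remains is the
  Lipschitz bound on \<open>h\<close>, whose pointwise maximum is at most
  \<open>E_norm (u1 - u2)\<close>.\<close>

lemma nemytskii_one_sided_lipschitz: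
  assumes t: "t \<in> {0..T}" and u: "u1 \<in> E_space \<Omega>" "u2 \<in> E_space \<Omega>" and \<xi>: "\<xi> \<in> \<Omega>"
    and less: "apply_bcontfun (u2 $ i) \<xi> < apply_bcontfun (u1 $ i) \<xi>"
  shows "apply_bcontfun (nemytskii \<Omega> f t u1 $ i) \<xi> - apply_bcontfun (nemytskii \<Omega> f t u2 $ i) \<xi>
    \<le> L T * E_norm (u1 - u2)"
proof -
  let ?x1 = "\<chi> k. apply_bcontfun (u1 $ k) \<xi>" and ?x2 = "\<chi> k. apply_bcontfun (u2 $ k) \<xi>"
  have "g i t \<xi> (apply_bcontfun (u1 $ i) \<xi>) \<le> g i t \<xi> (apply_bcontfun (u2 $ i) \<xi>)"
    using antimonoD[OF g_antimono[of t \<xi> i]] t \<xi> less by simp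
  moreover have "h i t \<xi> ?x1 - h i t \<xi> ?x2 \<le> L T * (SUP k. \<bar>?x1 $ k - ?x2 $ k\<bar>)"
    using h_lipschitz[of T t \<xi> i ?x1 ?x2] t \<xi> by auto
  moreover have "(SUP k. \<bar>?x1 $ k - ?x2 $ k\<bar>) \<le> E_norm (u1 - u2)"
  proof (rule cSUP_least)
    show "\<bar>?x1 $ k - ?x2 $ k\<bar> \<le> E_norm (u1 - u2)" for k
      using norm_bounded[of "(u1 - u2) $ k" \<xi>] norm_nth_le_E_norm[of "u1 - u2" k] by simp
  qed simp
  then have "L T * (SUP k. \<bar>?x1 $ k - ?x2 $ k\<bar>) \<le> L T * E_norm (u1 - u2)"
    using L_nonneg[of T] t by (intro mult_left_mono) auto
  ultimately show ?thesis
    using t u \<xi> by (simp add: nemytskii_apply)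
qed

lemma nemytskii_along_ET:
  assumes "T > 0" "w \<in> ET_space \<Omega> T"
  shows "continuous_on {0..T} (\<lambda>s. nemytskii \<Omega> f s (w s))"
    and "s \<in> {0..T} \<Longrightarrow> nemytskii \<Omega> f s (w s) \<in> E_space \<Omega>"
proof -
  have ET: "(\<lambda>t\<in>{0..T}. nemytskii \<Omega> f t (w t)) \<in> ET_space \<Omega> T"
    using F_maps_ET assms .
  show "continuous_on {0..T} (\<lambda>s. nemytskii \<Omega> f s (w s))"
    using ET_space_continuous[OF domain(2) ET] by (rule continuous_on_eq) simp
  show "nemytskii \<Omega> f s (w s) \<in> E_space \<Omega>" if "s \<in> {0..T}"
    using ET_space_mem[OF ET that] that by simp
qed

lemma semigroup_nemytskii_continuous:
  assumes "T > 0" "w \<in> ET_space \<Omega> T" and t: "t \<in> {0..T}"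
  shows "continuous_on {0..t} (\<lambda>s. S i (t - s) (nemytskii \<Omega> f s (w s) $ i))"
proof (rule semigroup_convolution_continuous[OF semigroup subspace_Et_space])
  show "continuous_on {0..t} (\<lambda>s. nemytskii \<Omega> f s (w s) $ i)"
    using nemytskii_along_ET(1)[OF assms(1,2)] t
    by (intro continuous_on_component) (auto intro: continuous_on_subset)
  show "nemytskii \<Omega> f s (w s) $ i \<in> Et_space \<Omega>" if "s \<in> {0..t}" for s
    using nemytskii_along_ET(2)[OF assms(1,2), of s] t that by (simp add: E_space_def)
qed

text \<open>Taking a coordinate is bounded linear and so commutes with the integral once the
  vector-valued integrand is known to be integrable. This permits working with one scalar semigroup
  \<open>S i\<close> at a time.\<close>

lemma solution_component:
  assumes T: "T > 0" and sol: "is_solution \<Omega> S f T z w" and t: "t \<in> {0..T}"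
  shows "w t $ i = integral {0..t} (\<lambda>s. S i (t - s) (nemytskii \<Omega> f s (w s) $ i)) + z t $ i"
proof -
  let ?\<Phi> = "\<lambda>s. diag_semigroup S (t - s) (nemytskii \<Omega> f s (w s))"
  have w: "w \<in> ET_space \<Omega> T" "w t = integral {0..t} ?\<Phi> + z t"
    using sol t by (auto simp: is_solution_def)
  have "continuous_on {0..t} ?\<Phi>"
    unfolding diag_semigroup_def
    by (intro continuous_on_vec_lambda semigroup_nemytskii_continuous[OF T w(1) t])
  then have "?\<Phi> integrable_on {0..t}" by (rule integrable_continuous_real)
  from integral_linear[OF this bounded_linear_vec_nth[of i]]
  have "integral {0..t} ?\<Phi> $ i = integral {0..t} (\<lambda>s. S i (t - s) (nemytskii \<Omega> f s (w s) $ i))"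
    by (simp add: o_def diag_semigroup_def)
  then show ?thesis using w(2) by simp
qed

text \<open>In the constant, the exponential bounds \<open>v\<close> and the summand 1 accounts for
  \<open>z1 - z2\<close>, which is added back to recover \<open>w1 - w2\<close>.\<close>

lemma solution_lipschitz:
  assumes T: "T > 0" and z: "z1 \<in> ET_space \<Omega> T" "z2 \<in> ET_space \<Omega> T"
    and sol: "is_solution \<Omega> S f T z1 w1" "is_solution \<Omega> S f T z2 w2"
  shows "ET_norm T (\<lambda>t. w1 t - w2 t)
    \<le> (1 + exp ((2 * L T + 1) * T)) * ET_norm T (\<lambda>t. z1 t - z2 t)"
proof -
  define \<delta> where "\<delta> = ET_norm T (\<lambda>t. z1 t - z2 t)"
  define v where "v t = (w1 t - w2 t) - (z1 t - z2 t)" for t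
  define G where "G t = nemytskii \<Omega> f t (w1 t) - nemytskii \<Omega> f t (w2 t)" for t
  have w: "w1 \<in> ET_space \<Omega> T" "w2 \<in> ET_space \<Omega> T"
    using sol by (auto simp: is_solution_def)
  note cont = ET_space_continuous[OF domain(2)]
  have Lpos: "0 \<le> L T" using L_nonneg T by simp
  have zd: "E_norm (z1 t - z2 t) \<le> \<delta>" if "t \<in> {0..T}" for t
    unfolding \<delta>_def using that z
    by (intro E_norm_le_ET_norm[of T "\<lambda>t. z1 t - z2 t"] continuous_intros cont)
  have \<delta>: "0 \<le> \<delta>" using zd[of 0] E_norm_nonneg[of "z1 0 - z2 0"] T by simp
  have wd: "E_norm (w1 t - w2 t) \<le> E_norm (v t) + \<delta>" if "t \<in> {0..T}" for t
    using E_norm_triangle[of "v t" "z1 t - z2 t"] zd[OF that] by (simp add: v_def)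
  have G_cont: "continuous_on {0..T} G"
    unfolding G_def by (intro continuous_intros nemytskii_along_ET T w)
  have G_mem: "G s $ i \<in> Et_space \<Omega>" if "s \<in> {0..T}" for s i
    using nemytskii_along_ET(2)[OF T w(1) that] nemytskii_along_ET(2)[OF T w(2) that]
    by (auto simp: G_def E_space_def intro: subspace_diff[OF subspace_Et_space])
  have v_cont: "continuous_on {0..T} v"
    unfolding v_def by (intro continuous_intros cont w z)
  have v_mem: "v t $ i \<in> Et_space \<Omega>" if "t \<in> {0..T}" for t i
    using that w z by (auto simp: v_def E_space_def dest!: ET_space_mem
        intro!: subspace_diff[OF subspace_Et_space])
  have v_eq: "v t $ i = integral {0..t} (\<lambda>s. S i (t - s) (G s $ i))" if t: "t \<in> {0..T}" for t i
  proof -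
    have "S i (t - s) (G s $ i) = S i (t - s) (nemytskii \<Omega> f s (w1 s) $ i)
        - S i (t - s) (nemytskii \<Omega> f s (w2 s) $ i)" if "s \<in> {0..t}" for s
      unfolding G_def vector_minus_component
      using nemytskii_along_ET(2)[OF T w(1), of s] nemytskii_along_ET(2)[OF T w(2), of s] t that
      by (intro semigroup_diff[OF semigroup subspace_Et_space]) (auto simp: E_space_def)
    then have "integral {0..t} (\<lambda>s. S i (t - s) (G s $ i)) =
        integral {0..t} (\<lambda>s. S i (t - s) (nemytskii \<Omega> f s (w1 s) $ i)
          - S i (t - s) (nemytskii \<Omega> f s (w2 s) $ i))"
      by (intro Henstock_Kurzweil_Integration.integral_cong)
    also have "\<dots> = integral {0..t} (\<lambda>s. S i (t - s) (nemytskii \<Omega> f s (w1 s) $ i))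
        - integral {0..t} (\<lambda>s. S i (t - s) (nemytskii \<Omega> f s (w2 s) $ i))"
      by (intro Henstock_Kurzweil_Integration.integral_diff integrable_continuous_real
          semigroup_nemytskii_continuous[OF T _ t] w)
    also have "\<dots> = v t $ i"
      using t by (simp add: v_def solution_component[OF T sol(1)] solution_component[OF T sol(2)])
    finally show ?thesis ..
  qed
  have step: "\<forall>\<^sub>F h in at_right 0. E_norm (v t) \<le> E_norm (v (t - h)) + h * (2 * L T * E_norm (v t) + e)"
    if t: "0 < t" "t \<le> T" and big: "\<delta> < E_norm (v t)" and e: "0 < e" for t e
  proof -
    have tT: "t \<in> {0..T}" using t by simp
    \<comment> \<open>The maximal component is chosen at time \<open>t\<close> and kept fixed while
      \<open>h\<close> varies; at time \<open>t - h\<close> its norm is still at most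
      \<open>E_norm (v (t - h))\<close>.\<close>
    obtain i where i: "E_norm (v t) = norm (v t $ i)" by (rule E_norm_attained)
    then have "v t $ i \<noteq> 0" using big \<delta> by auto
    then obtain \<xi> where \<xi>: "\<xi> \<in> \<Omega>" "\<bar>apply_bcontfun (v t $ i) \<xi>\<bar> = norm (v t $ i)"
      using Et_space_norm_attained[OF domain(2) v_mem[OF tT]] by blast
    \<comment> \<open>Evaluation at \<xi> times this sign is a linear functional of norm at most 1
      that attains the norm of \<open>v t $ i\<close>. Applied to
      \<open>v t $ i - h *\<^sub>R (G t $ i)\<close>, it bounds the norm of that vector from
      below.\<close>
    define \<sigma> where "\<sigma> = sgn (apply_bcontfun (v t $ i) \<xi>)"
    have \<sigma>: "\<bar>\<sigma>\<bar> \<le> 1" "\<sigma> * apply_bcontfun (v t $ i) \<xi> = norm (v t $ i)"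
      using \<xi>(2) by (auto simp: \<sigma>_def abs_sgn sgn_if)
    have "\<bar>apply_bcontfun (z1 t $ i) \<xi> - apply_bcontfun (z2 t $ i) \<xi>\<bar> \<le> \<delta>"
      using norm_bounded[of "(z1 t - z2 t) $ i" \<xi>] norm_nth_le_E_norm[of "z1 t - z2 t" i] zd[OF tT]
      by simp
    then have close: "\<bar>apply_bcontfun (w1 t $ i) \<xi> - apply_bcontfun (w2 t $ i) \<xi>
        - apply_bcontfun (v t $ i) \<xi>\<bar> \<le> \<delta>"
      by (simp add: v_def)
    have large: "\<delta> < \<bar>apply_bcontfun (v t $ i) \<xi>\<bar>"
      using \<xi>(2) i big by simp
    note dissip = nemytskii_one_sided_lipschitz[OF tT ET_space_mem[OF _ tT] ET_space_mem[OF _ tT] \<xi>(1), of _ _ i]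
    have "\<sigma> * apply_bcontfun (G t $ i) \<xi> \<le> L T * E_norm (w1 t - w2 t)"
    proof (cases "0 < apply_bcontfun (v t $ i) \<xi>")
      case True
      then have "apply_bcontfun (w2 t $ i) \<xi> < apply_bcontfun (w1 t $ i) \<xi>"
        using close large by linarith
      from dissip[OF w this] show ?thesis
        using True by (simp add: \<sigma>_def G_def)
    next
      case False
      then have neg: "apply_bcontfun (v t $ i) \<xi> < 0"
        using large \<delta> by linarith
      then have "apply_bcontfun (w1 t $ i) \<xi> < apply_bcontfun (w2 t $ i) \<xi>"
        using close large by linarith
      \<comment> \<open>For negative \<open>v\<close> the two solutions exchange roles; the factor
        \<open>\<sigma> = -1\<close> restores the sign.\<close>
      from dissip[OF w(2,1) this] show ?thesis
        using neg by (simp add: \<sigma>_def G_def E_norm_minus_commute[of "w2 t"])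
    qed
    also have "\<dots> \<le> L T * (2 * E_norm (v t))"
      using wd[OF tT] big Lpos by (intro mult_left_mono) auto
    finally have G_le: "\<sigma> * apply_bcontfun (G t $ i) \<xi> \<le> 2 * L T * E_norm (v t)" by simp
    have "\<forall>\<^sub>F h in at_right 0. norm (v t $ i - h *\<^sub>R (G t $ i)) \<le> norm (v (t - h) $ i) + h * e"
      by (rule mild_solution_left_increment[OF semigroup subspace_Et_space closed_Et_space
            continuous_on_component[OF G_cont] G_mem v_eq t e])
    moreover have "\<forall>\<^sub>F h::real in at_right 0. 0 < h"
      by (rule eventually_at_right_less)
    ultimately show ?thesis
    proof eventually_elim
      case (elim h)
      let ?d = "v t $ i - h *\<^sub>R (G t $ i)"
      have "\<sigma> * apply_bcontfun ?d \<xi> \<le> \<bar>\<sigma>\<bar> * \<bar>apply_bcontfun ?d \<xi>\<bar>"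
        unfolding abs_mult[symmetric] by (rule abs_ge_self)
      also have "\<dots> \<le> 1 * \<bar>apply_bcontfun ?d \<xi>\<bar>"
        using \<sigma>(1) by (rule mult_right_mono) simp
      also have "\<dots> \<le> norm ?d"
        using norm_bounded[of ?d \<xi>] by simp
      finally have "\<sigma> * apply_bcontfun ?d \<xi> \<le> norm ?d" .
      moreover have "\<sigma> * apply_bcontfun ?d \<xi>
          = norm (v t $ i) - h * (\<sigma> * apply_bcontfun (G t $ i) \<xi>)"
        using \<sigma>(2) by (simp add: algebra_simps)
      moreover have "h * (\<sigma> * apply_bcontfun (G t $ i) \<xi>) \<le> h * (2 * L T * E_norm (v t))"
        using G_le elim by (intro mult_left_mono) auto
      ultimately show ?case
        using elim(1) norm_nth_le_E_norm[of "v (t - h)" i]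
        unfolding i[symmetric] distrib_left by linarith
    qed
  qed
  have v_bound: "E_norm (v t) \<le> \<delta> * exp ((2 * L T + 1) * t)" if "t \<in> {0..T}" for t
  \<comment> \<open>Here \<open>c = 2 * L T\<close> and \<open>K = c + 1\<close>; the added 1 only
    secures the strict inequality \<open>c < K\<close>.\<close>
  proof (rule exp_growth_bound_of_left_increments[OF _ \<delta> _ _ _ step that])
    show "continuous_on {0..T} (\<lambda>t. E_norm (v t))"
      by (rule continuous_on_E_norm[OF v_cont])
    have "v 0 = 0" using v_eq[of 0] T by (simp add: vec_eq_iff)
    then show "E_norm (v 0) \<le> \<delta>" using \<delta> by (simp add: E_norm_eq_0_iff[THEN iffD2])
  qed (use Lpos in auto)
  have "E_norm (w1 t - w2 t) \<le> (1 + exp ((2 * L T + 1) * T)) * \<delta>" if t: "t \<in> {0..T}" for t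
  proof -
    have "\<delta> * exp ((2 * L T + 1) * t) \<le> \<delta> * exp ((2 * L T + 1) * T)"
      using t \<delta> Lpos by (intro mult_left_mono) (auto intro!: mult_left_mono)
    then show ?thesis
      using v_bound[OF t] wd[OF t] by (simp add: algebra_simps)
  qed
  then show ?thesis
    unfolding ET_norm_def[of T "\<lambda>t. w1 t - w2 t"] \<delta>_def[symmetric]
    using T by (intro cSUP_least) auto
qed

text \<open>Equal data make the right side of the Lipschitz estimate vanish, so the solutions agree
  on \<open>{0..T}\<close>. Extensionality of the members of \<open>ET_space\<close> turns this into
  equality of functions.\<close>

lemma solution_unique:
  assumes T: "T > 0" and z: "z \<in> ET_space \<Omega> T"
    and sol: "is_solution \<Omega> S f T z w1" "is_solution \<Omega> S f T z w2"
  shows "w1 = w2"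
proof -
  have w: "w1 \<in> ET_space \<Omega> T" "w2 \<in> ET_space \<Omega> T"
    using sol by (auto simp: is_solution_def)
  have "ET_norm T (\<lambda>t. z t - z t) = 0"
    using T by (simp add: ET_norm_def E_norm_eq_0_iff[THEN iffD2])
  then have le: "ET_norm T (\<lambda>t. w1 t - w2 t) \<le> 0"
    using solution_lipschitz[OF T z z sol] by simp
  have "w1 t = w2 t" if t: "t \<in> {0..T}" for t
  proof -
    have "E_norm (w1 t - w2 t) \<le> ET_norm T (\<lambda>t. w1 t - w2 t)"
      using t w by (intro E_norm_le_ET_norm[of T "\<lambda>t. w1 t - w2 t"] continuous_intros
          ET_space_continuous[OF domain(2)])
    then show ?thesis
      using le E_norm_nonneg[of "w1 t - w2 t"] E_norm_eq_0_iff[of "w1 t - w2 t"] by simp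
  qed
  moreover have "w1 \<in> extensional {0..T}" "w2 \<in> extensional {0..T}"
    using w by (auto simp: ET_space_def PiE_def)
  ultimately show ?thesis by (intro extensionalityI)
qed

end

section \<open>Lipschitz dependence with a uniform constant, and uniqueness\<close>

text \<open>Choosing \<open>C\<close> before the domain, the operators and the nonlinearity
  expresses that the constant depends only on \<open>T\<close> and \<open>L T\<close>. In the last
  clause existence is supplied by \<open>M z\<close>, so only uniqueness has to be proved.\<close>

theorem theorem6p2:
  shows "\<exists>C :: real \<Rightarrow> real \<Rightarrow> real.
    (\<forall>T>0. \<forall>l\<ge>0. C T l > 0) \<and>
    (\<forall>(\<Omega> :: (real^'d::finite) set) \<kappa> a b
       (S :: 'r::finite \<Rightarrow> real \<Rightarrow> ((real^'d) \<Rightarrow>\<^sub>C real) \<Rightarrow> ((real^'d) \<Rightarrow>\<^sub>C real)) f g h L.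
       reaction_diffusion_system \<Omega> \<kappa> a b S f g h L \<longrightarrow>
       (\<forall>T>0. \<forall>M :: (real \<Rightarrow> ((real^'d) \<Rightarrow>\<^sub>C real)^'r) \<Rightarrow> (real \<Rightarrow> ((real^'d) \<Rightarrow>\<^sub>C real)^'r).
          (\<forall>z\<in>ET_space \<Omega> T. is_solution \<Omega> S f T z (M z)) \<longrightarrow>
          (\<forall>z1\<in>ET_space \<Omega> T. \<forall>z2\<in>ET_space \<Omega> T.
             ET_norm T (\<lambda>t. M z1 t - M z2 t) \<le> C T (L T) * ET_norm T (\<lambda>t. z1 t - z2 t)) \<and>
          (\<forall>z\<in>ET_space \<Omega> T. \<exists>!w. is_solution \<Omega> S f T z w)))"
proof (intro exI[of _ "\<lambda>T l. 1 + exp ((2 * l + 1) * T)"] conjI allI impI ballI, goal_cases)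
  case (1 T l)
  show ?case by (simp add: add_pos_pos)
next
  case (2 \<Omega> \<kappa> a b S f g h L T M z1 z2)
  then show ?case
    by (intro reaction_diffusion_system.solution_lipschitz) auto
next
  case (3 \<Omega> \<kappa> a b S f g h L T M z)
  then show ?case
    using reaction_diffusion_system.solution_unique by blast
qed

end
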